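(* Let $U$ be a bounded domain in $\mathbb{R}^n$, let $u:U\to\mathbb{R}$ be continuous, and let $g:U\to\mathbb{R}$ be continuous. Then $u$ satisfies $g$-quadratic comparison on $U$ if and only if $u$ is a viscosity solution of $\Delta_\infty u=g$ in $U$.
   Context: Viscosity solutions. For a $C^2$ function $\phi$ near $x$ with $\nabla\phi(x)\neq0$, $\Delta_\infty\phi(x)=|\nabla\phi|^{-2}\sum_{i,j}\phi_{x_i}\phi_{x_ix_j}\phi_{x_j}$ (evaluated at $x$); if $\nabla\phi(x)=0$ and the limit $\lim_{x'\to x}2\frac{\phi(x')-\phi(x)}{|x'-x|^2}$ exists, $\Delta_\infty\phi(x)$ is defined to be this limit. Let $S(x)$ be the set of real functions $\phi$ that are defined and $C^2$ in a neighborhood of $x$ and for which $\Delta_\infty\phi(x)$ is defined in one of these two ways. For continuous $u$ put $$\Delta_\infty^+u(x)=\inf\{\Delta_\infty\phi(x):\phi\in S(x),\ x\text{ is a local minimum of }\phi-u\},$$ $$\Delta_\infty^-u(x)=\sup\{\Delta_\infty\phi(x):\phi\in S(x),\ x\text{ is a local maximum of }\phi-u\}.$$ $u$ is a viscosity solution of $\Delta_\infty u=g$ in $U$ if $\Delta_\infty^-u\le g\le\Delta_\infty^+u$ at every point of $U$. Quadratic comparison (with ambient length space $\mathbb{R}^n$, $d(x,z)=|x-z|$). A quadratic distance function centered at $z\in\mathbb{R}^n$ is a function $\phi(x)=Q(d(x,z))$ with $Q(r)=ar^2+br+c$, $a,b,c\in\mathbb{R}$; $a$ is its quadratic term. It is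 $\star$-increasing on an open set $V$ if either (1) $z\notin V$ and $Q'(d(x,z))>0$ for every $x\in V$, or (2) $z\in V$, $b=0$ and $a>0$. It is $\star$-decreasing on $V$ if $-\phi$ is $\star$-increasing on $V$. A continuous $u:U\to\mathbb{R}$ satisfies $g$-quadratic comparison on $U$ if both of the following hold. - From above: for every open $V\subset\overline V\subset U$ and every quadratic distance function $\phi$ that is $\star$-increasing on $V$ with quadratic term $a\le\inf_{y\in V}\frac{g(y)}2$, the inequality $\phi\ge u$ on $\partial V$ implies $\phi\ge u$ on $V$. - From below: for every open $V\subset\overline V\subset U$ and every quadratic distance function $\phi$ that is $\star$-decreasing on $V$ with quadratic term $a\ge\sup_{y\in V}\frac{g(y)}2$, the inequality $\phi\le u$ on $\partial V$ implies $\phi\le u$ on $V$. Closures and boundaries are taken in $\mathbb{R}^n$. *)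

theory Defs
  imports "HOL-Analysis.Analysis"
begin

definition partial_deriv :: "'n::finite \<Rightarrow> (real^'n \<Rightarrow> real) \<Rightarrow> real^'n \<Rightarrow> real" where
  "partial_deriv i f x = frechet_derivative f (at x) (axis i 1)"

definition grad :: "(real^'n::finite \<Rightarrow> real) \<Rightarrow> real^'n \<Rightarrow> real^'n" where
  "grad f x = (\<chi> i. partial_deriv i f x)"

definition C1_on :: "(real^'n::finite) set \<Rightarrow> (real^'n \<Rightarrow> real) \<Rightarrow> bool" where
  "C1_on N f \<longleftrightarrow> (\<forall>y\<in>N. f differentiable at y) \<and> (\<forall>i. continuous_on N (partial_deriv i f))"

definition C2_on :: "(real^'n::finite) set \<Rightarrow> (real^'n \<Rightarrow> real) \<Rightarrow> bool" where
  "C2_on N f \<longleftrightarrow> (\<forall>y\<in>N. f differentiable at y) \<and> (\<forall>i. C1_on N (partial_deriv i f))"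

definition C2_near :: "(real^'n::finite \<Rightarrow> real) \<Rightarrow> real^'n \<Rightarrow> bool" where
  "C2_near f x \<longleftrightarrow> (\<exists>N. open N \<and> x \<in> N \<and> C2_on N f)"

definition second_order_quotient :: "(real^'n::finite \<Rightarrow> real) \<Rightarrow> real^'n \<Rightarrow> real^'n \<Rightarrow> real" where
  "second_order_quotient f x x' = 2 * (f x' - f x) / (norm (x' - x))\<^sup>2"

text \<open>At a critical point where the limit does not exist the value is unspecified;
  such functions are excluded from \<open>test_functions\<close>.\<close>

definition inf_laplacian :: "(real^'n::finite \<Rightarrow> real) \<Rightarrow> real^'n \<Rightarrow> real" where
  "inf_laplacian f x =
     (if grad f x \<noteq> 0
      then (\<Sum>i\<in>UNIV. \<Sum>j\<in>UNIV. partial_deriv i f x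
              * partial_deriv j (partial_deriv i f) x * partial_deriv j f x) / (norm (grad f x))\<^sup>2
      else Lim (at x) (second_order_quotient f x))"

text \<open>The set \<open>S(x)\<close>. Its elements are total functions, but membership and all later uses
  depend only on their values near \<open>x\<close>.\<close>

definition test_functions :: "real^'n::finite \<Rightarrow> (real^'n \<Rightarrow> real) set" where
  "test_functions x =
     {f. C2_near f x \<and>
         (grad f x \<noteq> 0 \<or> (\<exists>L. (second_order_quotient f x \<longlongrightarrow> L) (at x)))}"

definition local_min_at :: "('a::topological_space \<Rightarrow> real) \<Rightarrow> 'a \<Rightarrow> bool" where
  "local_min_at f x \<longleftrightarrow> (\<forall>\<^sub>F y in nhds x. f x \<le> f y)"

definition local_max_at :: "('a::topological_space \<Rightarrow> real) \<Rightarrow> 'a \<Rightarrow> bool" where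
  "local_max_at f x \<longleftrightarrow> (\<forall>\<^sub>F y in nhds x. f y \<le> f x)"

text \<open>Extended reals, since there may be no admissible test function
  (infimum \<open>\<infinity>\<close>, supremum \<open>-\<infinity>\<close>).\<close>

definition inf_laplacian_upper :: "(real^'n::finite \<Rightarrow> real) \<Rightarrow> real^'n \<Rightarrow> ereal" where
  "inf_laplacian_upper u x =
     (INF f \<in> {f \<in> test_functions x. local_min_at (\<lambda>y. f y - u y) x}. ereal (inf_laplacian f x))"

definition inf_laplacian_lower :: "(real^'n::finite \<Rightarrow> real) \<Rightarrow> real^'n \<Rightarrow> ereal" where
  "inf_laplacian_lower u x =
     (SUP f \<in> {f \<in> test_functions x. local_max_at (\<lambda>y. f y - u y) x}. ereal (inf_laplacian f x))"

definition viscosity_solution ::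
    "(real^'n::finite) set \<Rightarrow> (real^'n \<Rightarrow> real) \<Rightarrow> (real^'n \<Rightarrow> real) \<Rightarrow> bool" where
  "viscosity_solution U g u \<longleftrightarrow>
     continuous_on U u \<and>
     (\<forall>x\<in>U. inf_laplacian_lower u x \<le> ereal (g x) \<and> ereal (g x) \<le> inf_laplacian_upper u x)"

definition quadratic :: "real \<Rightarrow> real \<Rightarrow> real \<Rightarrow> real \<Rightarrow> real" where
  "quadratic a b c r = a * r\<^sup>2 + b * r + c"

definition quadratic_distance ::
    "real^'n::finite \<Rightarrow> real \<Rightarrow> real \<Rightarrow> real \<Rightarrow> real^'n \<Rightarrow> real" where
  "quadratic_distance z a b c x = quadratic a b c (dist x z)"

text \<open>The next two predicates concern the function \<open>quadratic_distance z a b c\<close>, presented by its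
  center and coefficients; its negative has coefficients \<open>-a\<close>, \<open>-b\<close>, \<open>-c\<close>.\<close>

definition star_increasing ::
    "(real^'n::finite) set \<Rightarrow> real^'n \<Rightarrow> real \<Rightarrow> real \<Rightarrow> real \<Rightarrow> bool" where
  "star_increasing V z a b c \<longleftrightarrow>
     (z \<notin> V \<and> (\<forall>x\<in>V. deriv (quadratic a b c) (dist x z) > 0)) \<or>
     (z \<in> V \<and> b = 0 \<and> a > 0)"

definition star_decreasing ::
    "(real^'n::finite) set \<Rightarrow> real^'n \<Rightarrow> real \<Rightarrow> real \<Rightarrow> real \<Rightarrow> bool" where
  "star_decreasing V z a b c \<longleftrightarrow> star_increasing V z (- a) (- b) (- c)"

definition quadratic_comparison_above ::
    "(real^'n::finite) set \<Rightarrow> (real^'n \<Rightarrow> real) \<Rightarrow> (real^'n \<Rightarrow> real) \<Rightarrow> bool" where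
  "quadratic_comparison_above U g u \<longleftrightarrow>
     (\<forall>V z a b c. open V \<longrightarrow> closure V \<subseteq> U \<longrightarrow>
        star_increasing V z a b c \<longrightarrow> ereal a \<le> (INF y\<in>V. ereal (g y / 2)) \<longrightarrow>
        (\<forall>x\<in>frontier V. quadratic_distance z a b c x \<ge> u x) \<longrightarrow>
        (\<forall>x\<in>V. quadratic_distance z a b c x \<ge> u x))"

definition quadratic_comparison_below ::
    "(real^'n::finite) set \<Rightarrow> (real^'n \<Rightarrow> real) \<Rightarrow> (real^'n \<Rightarrow> real) \<Rightarrow> bool" where
  "quadratic_comparison_below U g u \<longleftrightarrow>
     (\<forall>V z a b c. open V \<longrightarrow> closure V \<subseteq> U \<longrightarrow>
        star_decreasing V z a b c \<longrightarrow> ereal a \<ge> (SUP y\<in>V. ereal (g y / 2)) \<longrightarrow>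
        (\<forall>x\<in>frontier V. quadratic_distance z a b c x \<le> u x) \<longrightarrow>
        (\<forall>x\<in>V. quadratic_distance z a b c x \<le> u x))"

definition quadratic_comparison ::
    "(real^'n::finite) set \<Rightarrow> (real^'n \<Rightarrow> real) \<Rightarrow> (real^'n \<Rightarrow> real) \<Rightarrow> bool" where
  "quadratic_comparison U g u \<longleftrightarrow>
     continuous_on U u \<and> quadratic_comparison_above U g u \<and> quadratic_comparison_below U g u"

end

theory Submission
  imports Defs
begin

text \<open>
  Replacing \<open>u, g\<close> by \<open>-u, -g\<close> exchanges the two halves of both notions, so it suffices to treat
  comparison from above and touching from above.

  A quadratic distance function has infinity Laplacian \<open>2 a\<close> wherever it is a test function. If
  comparison fails on \<open>V\<close>, lower \<open>a\<close> slightly and let \<open>w\<close> be a maximum point of \<open>u - \<phi>\<close> over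
  \<open>closure V\<close>: then \<open>\<phi>\<close> itself is a test function at \<open>w\<close> contradicting the viscosity inequality.

  Conversely, let a test function \<open>f\<close> touch \<open>u\<close> from above at \<open>x\<close> with infinity Laplacian below
  \<open>g x\<close>. In the noncritical case a quadratic distance function with center close to \<open>x\<close> and
  \<open>2 a < g x\<close> touches \<open>f\<close> strictly from above; in the critical case with \<open>g x > 0\<close> one takes a
  paraboloid centered at \<open>x\<close>. Moving it down violates comparison on a small ball. In the critical
  case with \<open>g x \<le> 0\<close> no function centered at \<open>x\<close> is admissible; instead a function with a distant
  center and a small slope is used, on the set where it lies below \<open>u\<close>.
\<close>

section \<open>Gradient and Hessian\<close>

text \<open>Row \<open>i\<close> is the gradient of the \<open>i\<close>-th partial derivative, so
  \<open>hessian f x *v v\<close> is the derivative of \<open>grad f\<close> along \<open>v\<close>,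
  with no appeal to symmetry of mixed partials.\<close>

definition hessian :: "(real^'n::finite \<Rightarrow> real) \<Rightarrow> real^'n \<Rightarrow> real^'n^'n" where
  "hessian f x = (\<chi> i j. partial_deriv j (partial_deriv i f) x)"

lemma partial_deriv_eqI:
  assumes "(f has_derivative f') (at x)"
  shows "partial_deriv i f x = f' (axis i 1)"
  using frechet_derivative_at[OF assms] by (simp add: partial_deriv_def)

lemma frechet_derivative_eq_partial_derivs:
  fixes f :: "real^'n::finite \<Rightarrow> real"
  assumes "f differentiable at x"
  shows "frechet_derivative f (at x) v = (\<Sum>i\<in>UNIV. v $ i * partial_deriv i f x)"
proof -
  interpret linear "frechet_derivative f (at x)"
    using assms by (rule linear_frechet_derivative)
  have "frechet_derivative f (at x) v
      = frechet_derivative f (at x) (\<Sum>i\<in>UNIV. v $ i *\<^sub>R axis i 1)"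
    by (simp add: basis_expansion scalar_mult_eq_scaleR[symmetric])
  also have "\<dots> = (\<Sum>i\<in>UNIV. v $ i * partial_deriv i f x)"
    by (simp add: sum scale partial_deriv_def)
  finally show ?thesis .
qed

lemma has_derivative_grad:
  fixes f :: "real^'n::finite \<Rightarrow> real"
  assumes "f differentiable at x"
  shows "(f has_derivative (\<lambda>v. grad f x \<bullet> v)) (at x)"
proof -
  have "frechet_derivative f (at x) = (\<lambda>v. grad f x \<bullet> v)"
    using frechet_derivative_eq_partial_derivs[OF assms]
    by (simp add: fun_eq_iff grad_def inner_vec_def mult.commute)
  then show ?thesis
    using assms by (metis frechet_derivative_works)
qed

text \<open>Passes from the coordinatewise definition to Frechet derivatives, the form used for
  calculation.\<close>

lemma C2_onD:
  fixes f :: "real^'n::finite \<Rightarrow> real"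
  assumes "C2_on N f"
  shows "\<And>y. y \<in> N \<Longrightarrow> (f has_derivative (\<lambda>v. grad f y \<bullet> v)) (at y)"
    and "\<And>y. y \<in> N \<Longrightarrow> (grad f has_derivative (\<lambda>v. hessian f y *v v)) (at y)"
    and "continuous_on N (hessian f)"
proof -
  show "(f has_derivative (\<lambda>v. grad f y \<bullet> v)) (at y)" if "y \<in> N" for y
    using assms that by (intro has_derivative_grad) (auto simp: C2_on_def)
  show "(grad f has_derivative (\<lambda>v. hessian f y *v v)) (at y)" if "y \<in> N" for y
  proof -
    have d: "partial_deriv i f differentiable at y" for i
      using assms that by (auto simp: C2_on_def C1_on_def)
    have "((\<lambda>x. grad f x $ i) has_derivative (\<lambda>v. (hessian f y *v v) $ i)) (at y)" for i
      using has_derivative_grad[OF d[of i]]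
      by (simp add: hessian_def grad_def matrix_vector_mult_def inner_vec_def)
    then show ?thesis
      unfolding has_derivative_componentwise_within[of "grad f"]
      by (auto simp: Basis_vec_def inner_axis)
  qed
  show "continuous_on N (hessian f)"
    using assms unfolding hessian_def C2_on_def C1_on_def
    by (auto intro!: continuous_on_vec_lambda)
qed

text \<open>The converse passage, for explicit candidates \<open>G\<close> and \<open>H\<close>.
  Since \<open>N\<close> is open, the partial derivatives agree with the components of
  \<open>G\<close> near each point and can be differentiated again.\<close>

lemma C2_onI:
  fixes f :: "real^'n::finite \<Rightarrow> real"
  assumes N: "open N"
    and f: "\<And>y. y \<in> N \<Longrightarrow> (f has_derivative (\<lambda>v. G y \<bullet> v)) (at y)"
    and G: "\<And>y. y \<in> N \<Longrightarrow> (G has_derivative (\<lambda>v. H y *v v)) (at y)"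
    and H: "continuous_on N H"
  shows "C2_on N f"
    and "\<And>y. y \<in> N \<Longrightarrow> grad f y = G y"
    and "\<And>y. y \<in> N \<Longrightarrow> hessian f y = H y"
proof -
  have p: "partial_deriv i f y = G y $ i" if "y \<in> N" for y i
    using partial_deriv_eqI[OF f[OF that], of i] by (simp add: inner_axis)
  have dp: "(partial_deriv i f has_derivative (\<lambda>v. (H y *v v) $ i)) (at y)" if "y \<in> N" for y i
  proof (rule has_derivative_transform_within_open[OF _ N that])
    show "((\<lambda>x. G x $ i) has_derivative (\<lambda>v. (H y *v v) $ i)) (at y)"
      by (rule bounded_linear.has_derivative[OF bounded_linear_vec_nth G[OF that]])
  qed (simp add: p)
  have pp: "partial_deriv j (partial_deriv i f) y = H y $ i $ j" if "y \<in> N" for y i j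
    using partial_deriv_eqI[OF dp[OF that], of j i]
    by (simp add: matrix_vector_mult_basis column_def)
  show "grad f y = G y" if "y \<in> N" for y
    using p[OF that] by (simp add: grad_def vec_eq_iff)
  show "hessian f y = H y" if "y \<in> N" for y
    using pp[OF that] by (simp add: hessian_def vec_eq_iff)
  have "continuous_on N (partial_deriv j (partial_deriv i f))" for i j
    using pp by (subst continuous_on_cong[OF refl, where g="\<lambda>y. H y $ i $ j"])
      (auto intro!: continuous_intros H)
  moreover have "f differentiable at y" if "y \<in> N" for y
    using f[OF that] by (auto simp: differentiable_def)
  moreover have "partial_deriv i f differentiable at y" if "y \<in> N" for y i
    using dp[OF that] by (auto simp: differentiable_def)
  ultimately show "C2_on N f"
    by (auto simp: C2_on_def C1_on_def)
qed

lemma inf_laplacian_hessian: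
  assumes "grad f x \<noteq> 0"
  shows "inf_laplacian f x = (grad f x \<bullet> (hessian f x *v grad f x)) / (norm (grad f x))\<^sup>2"
  using assms
  by (simp add: inf_laplacian_def hessian_def grad_def inner_vec_def matrix_vector_mult_def
      sum_distrib_left mult.assoc)

text \<open>A bilinear map in finite dimension is bounded, with a constant uniform in
  \<open>A\<close>; so closeness of Hessians in norm becomes closeness of their quadratic
  forms.\<close>

lemma norm_matrix_vector_mult_le:
  "\<exists>C>0. \<forall>(A :: real^'n::finite^'n) v. norm (A *v v) \<le> C * norm A * norm v"
proof -
  have "bilinear ((*v) :: real^'n^'n \<Rightarrow> real^'n \<Rightarrow> real^'n)"
    unfolding bilinear_def
    by (auto intro!: linearI simp: matrix_vector_mult_add_rdistrib matrix_vector_right_distrib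
        matrix_vector_mult_scaleR scaleR_matrix_vector_assoc)
  from bilinear_bounded_pos[OF this] show ?thesis by blast
qed

text \<open>By compactness of the unit sphere the form at \<open>x\<close> is at least
  \<open>m * (norm v)\<^sup>2\<close> with \<open>m > 0\<close>. Continuity of \<open>H\<close>
  keeps it positive definite on a ball, and two uses of the mean value theorem on the segment from
  \<open>x\<close> to \<open>y\<close> give the strict inequality.\<close>

lemma strict_local_min_second_derivative:
  fixes f :: "real^'n::finite \<Rightarrow> real"
  assumes N: "open N" "x \<in> N"
    and f: "\<And>y. y \<in> N \<Longrightarrow> (f has_derivative (\<lambda>v. G y \<bullet> v)) (at y)"
    and G: "\<And>y. y \<in> N \<Longrightarrow> (G has_derivative (\<lambda>v. H y *v v)) (at y)"
    and H: "continuous_on N H"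
    and crit: "G x = 0"
    and pos: "\<And>v. v \<noteq> 0 \<Longrightarrow> v \<bullet> (H x *v v) > 0"
  shows "\<forall>\<^sub>F y in at x. f x < f y"
proof -
  obtain C where C: "C > 0" "\<And>(A :: real^'n^'n) v. norm (A *v v) \<le> C * norm A * norm v"
    using norm_matrix_vector_mult_le by blast
  obtain w where w: "w \<in> sphere 0 1"
      "\<And>v. v \<in> sphere 0 1 \<Longrightarrow> w \<bullet> (H x *v w) \<le> v \<bullet> (H x *v v)"
  proof -
    have "\<exists>w\<in>sphere (0::real^'n) 1. \<forall>v\<in>sphere 0 1. w \<bullet> (H x *v w) \<le> v \<bullet> (H x *v v)"
      by (rule continuous_attains_inf)
        (auto intro!: continuous_intros matrix_vector_mult_linear_continuous_on)
    then show ?thesis using that by blast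
  qed
  define m where "m = w \<bullet> (H x *v w)"
  have "w \<noteq> 0" using w(1) by auto
  then have m: "m > 0" using pos unfolding m_def by blast
  have mv: "m * (norm v)\<^sup>2 \<le> v \<bullet> (H x *v v)" for v
  proof (cases "v = 0")
    case False
    have "m \<le> (v /\<^sub>R norm v) \<bullet> (H x *v (v /\<^sub>R norm v))"
      unfolding m_def using False by (intro w(2)) auto
    also have "\<dots> = (v \<bullet> (H x *v v)) / (norm v)\<^sup>2"
      by (simp add: matrix_vector_mult_scaleR power2_eq_square divide_simps)
    finally show ?thesis using False by (simp add: field_simps)
  qed simp
  \<comment> \<open>A change of the matrix by less than \<open>m / C\<close> changes the form by
    less than \<open>m * (norm v)\<^sup>2\<close>.\<close>
  have "isCont H x" using H N continuous_on_eq_continuous_at by blast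
  then have "\<forall>\<^sub>F y in at x. dist (H y) (H x) < m / C"
    using m C(1) by (auto simp: isCont_def tendsto_iff)
  moreover have "\<forall>\<^sub>F y in at x. y \<in> N"
    using N by (rule eventually_at_in_open')
  ultimately have "\<forall>\<^sub>F y in at x. y \<in> N \<and> dist (H y) (H x) < m / C"
    by eventually_elim auto
  then obtain d where d: "d > 0"
      "\<And>y. dist y x < d \<Longrightarrow> y \<noteq> x \<Longrightarrow> y \<in> N \<and> dist (H y) (H x) < m / C"
    by (auto simp: eventually_at)
  have d': "y \<in> N" "dist (H y) (H x) < m / C" if "dist y x < d" for y
    using d(2)[OF that] N(2) m C(1) by (cases "y = x"; auto)+
  have Hpos: "v \<bullet> (H y *v v) > 0" if "dist y x < d" "v \<noteq> 0" for y v
  proof -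
    have "v \<bullet> (H x *v v) - v \<bullet> (H y *v v) = v \<bullet> ((H x - H y) *v v)"
      by (simp add: matrix_vector_mult_diff_rdistrib inner_diff_right)
    also have "\<dots> \<le> norm v * norm ((H x - H y) *v v)" by (rule norm_cauchy_schwarz)
    also have "\<dots> \<le> norm v * (C * norm (H x - H y) * norm v)"
      by (intro mult_left_mono C) auto
    also have "\<dots> = C * dist (H y) (H x) * (norm v)\<^sup>2"
      by (simp add: dist_norm norm_minus_commute power2_eq_square)
    also have "\<dots> < m * (norm v)\<^sup>2"
      using d'(2)[OF that(1)] that(2) C(1) by (intro mult_strict_right_mono) (auto simp: field_simps)
    finally show ?thesis using mv[of v] by linarith
  qed
  have "f x < f y" if y: "y \<noteq> x" "dist y x < d" for y
  proof -
    define v where "v = y - x"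
    have near: "dist (x + t *\<^sub>R v) x < d" if "0 \<le> t" "t \<le> 1" for t
    proof -
      have "\<bar>t\<bar> * norm v \<le> 1 * norm v" using that by (intro mult_right_mono) auto
      then show ?thesis using y(2) by (simp add: v_def dist_norm)
    qed
    have line: "((\<lambda>t. x + t *\<^sub>R v) has_derivative (\<lambda>t. t *\<^sub>R v)) (at t)" for t
      by (auto intro!: derivative_eq_intros)
    have 1: "((\<lambda>t. f (x + t *\<^sub>R v)) has_real_derivative G (x + t *\<^sub>R v) \<bullet> v) (at t)"
      if "0 \<le> t" "t \<le> 1" for t
      using has_derivative_compose[OF line f[OF d'(1)[OF near[OF that]]]]
      by (simp add: has_field_derivative_def mult.commute[of _ "inner _ _"] fun_eq_iff)
    have 2: "((\<lambda>t. G (x + t *\<^sub>R v) \<bullet> v) has_real_derivative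
        v \<bullet> (H (x + t *\<^sub>R v) *v v)) (at t)" if "0 \<le> t" "t \<le> 1" for t
      using has_derivative_inner_left[OF has_derivative_compose[OF line G[OF d'(1)[OF near[OF that]]]], of v]
      by (simp add: has_field_derivative_def matrix_vector_mult_scaleR inner_commute
          mult.commute[of _ "inner _ _"] fun_eq_iff)
    obtain t where t: "0 < t" "t < 1" "f (x + 1 *\<^sub>R v) - f (x + 0 *\<^sub>R v) = (1 - 0) * (G (x + t *\<^sub>R v) \<bullet> v)"
      using MVT2[of 0 1 "\<lambda>t. f (x + t *\<^sub>R v)" "\<lambda>t. G (x + t *\<^sub>R v) \<bullet> v"] 1 by auto
    obtain s where s: "0 < s" "s < t" "G (x + t *\<^sub>R v) \<bullet> v - G (x + 0 *\<^sub>R v) \<bullet> v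
        = (t - 0) * (v \<bullet> (H (x + s *\<^sub>R v) *v v))"
      using MVT2[of 0 t "\<lambda>t. G (x + t *\<^sub>R v) \<bullet> v" "\<lambda>t. v \<bullet> (H (x + t *\<^sub>R v) *v v)"] 2 t by auto
    have "v \<bullet> (H (x + s *\<^sub>R v) *v v) > 0"
      using s t y by (intro Hpos near) (auto simp: v_def)
    with s t crit have "G (x + t *\<^sub>R v) \<bullet> v > 0" by simp
    with t show ?thesis by (simp add: v_def)
  qed
  with d(1) show ?thesis by (auto simp: eventually_at)
qed

section \<open>Quadratic distance functions\<close>

text \<open>At the center \<open>y = z\<close> these are only meaningful for \<open>b = 0\<close>; then \<open>b / 0 = 0\<close> gives the
  right value.\<close>

definition qd_grad :: "real^'n::finite \<Rightarrow> real \<Rightarrow> real \<Rightarrow> real^'n \<Rightarrow> real^'n" where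
  "qd_grad z a b y = (2 * a + b / dist y z) *\<^sub>R (y - z)"

definition qd_hessian :: "real^'n::finite \<Rightarrow> real \<Rightarrow> real \<Rightarrow> real^'n \<Rightarrow> real^'n^'n" where
  "qd_hessian z a b y = (2 * a + b / dist y z) *\<^sub>R mat 1
     - (b / dist y z ^ 3) *\<^sub>R (\<chi> i j. (y - z) $ i * (y - z) $ j)"

lemma qd_hessian_mult:
  "qd_hessian z a b y *v v
     = (2 * a + b / dist y z) *\<^sub>R v - (b / dist y z ^ 3 * ((y - z) \<bullet> v)) *\<^sub>R (y - z)"
proof -
  have "(\<chi> i j. (y - z) $ i * (y - z) $ j) *v v = ((y - z) \<bullet> v) *\<^sub>R (y - z)"
    by (simp add: vec_eq_iff matrix_vector_mult_def inner_vec_def sum_distrib_left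
        mult.assoc mult.commute mult.left_commute)
  then show ?thesis
    by (simp add: qd_hessian_def matrix_vector_mult_diff_rdistrib scaleR_matrix_vector_assoc[symmetric])
qed

lemma inner_qd_hessian:
  "v \<bullet> (qd_hessian z a b y *v v)
     = (2 * a + b / dist y z) * (norm v)\<^sup>2 - b / dist y z ^ 3 * ((y - z) \<bullet> v)\<^sup>2"
  unfolding qd_hessian_mult
  by (simp add: inner_diff_right inner_diff_left power2_norm_eq_inner inner_commute)
    (simp add: power2_eq_square)

lemma has_derivative_dist_left:
  fixes y z :: "'a::real_inner"
  assumes "y \<noteq> z"
  shows "((\<lambda>y. dist y z) has_derivative (\<lambda>v. ((y - z) \<bullet> v) / dist y z)) (at y)"
proof -
  have "((\<lambda>y. norm (y - z)) has_derivative (\<lambda>v. v \<bullet> sgn (y - z))) (at y)"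
    using assms by (intro has_derivative_compose[OF _ has_derivative_norm])
      (auto intro!: derivative_eq_intros)
  then show ?thesis
    by (simp add: dist_norm sgn_div_norm inner_commute divide_inverse_commute)
qed

lemma quadratic_distance_has_derivative:
  fixes z :: "real^'n::finite"
  assumes "y \<noteq> z \<or> b = 0"
  shows "(quadratic_distance z a b c has_derivative (\<lambda>v. qd_grad z a b y \<bullet> v)) (at y)"
proof -
  \<comment> \<open>The squared distance, written as an inner product, is differentiable at the
    center too, where the distance itself is not.\<close>
  have "((\<lambda>y. a * ((y - z) \<bullet> (y - z)) + b * dist y z + c) has_derivative
      (\<lambda>v. qd_grad z a b y \<bullet> v)) (at y)"
  proof (cases "b = 0")
    case True
    then show ?thesis
      by (auto intro!: derivative_eq_intros simp: qd_grad_def inner_commute)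
  next
    case False
    with assms show ?thesis
      by (auto intro!: derivative_eq_intros has_derivative_dist_left
          simp: qd_grad_def inner_commute algebra_simps diff_divide_distrib)
  qed
  then show ?thesis
    by (simp add: quadratic_distance_def[abs_def] quadratic_def dist_norm power2_norm_eq_inner)
qed

lemma qd_grad_has_derivative:
  fixes z :: "real^'n::finite"
  assumes "y \<noteq> z \<or> b = 0"
  shows "(qd_grad z a b has_derivative (\<lambda>v. qd_hessian z a b y *v v)) (at y)"
proof (cases "b = 0")
  case True
  then show ?thesis
    unfolding qd_hessian_mult qd_grad_def[abs_def]
    by (auto intro!: derivative_eq_intros)
next
  case False
  with assms have yz: "y \<noteq> z" by simp
  have "((\<lambda>y. 2 * a + b / dist y z) has_derivative
      (\<lambda>v. - (b / dist y z ^ 3 * ((y - z) \<bullet> v)))) (at y)"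
  proof -
    have "((\<lambda>y. 2 * a + b * inverse (dist y z)) has_derivative (\<lambda>v. 0 + b *
        - (inverse (dist y z) * (((y - z) \<bullet> v) / dist y z) * inverse (dist y z)))) (at y)"
      using yz by (intro has_derivative_add has_derivative_const has_derivative_mult_right
          Deriv.has_derivative_inverse has_derivative_dist_left) auto
    then show ?thesis
      by (simp add: divide_inverse power3_eq_cube mult_ac)
  qed
  then show ?thesis
    unfolding qd_hessian_mult qd_grad_def[abs_def]
    by (rule has_derivative_eq_rhs[OF has_derivative_scaleR])
      (auto intro!: derivative_eq_intros simp: fun_eq_iff)
qed

lemma continuous_on_qd_hessian:
  assumes "b \<noteq> 0 \<Longrightarrow> z \<notin> N"
  shows "continuous_on N (qd_hessian z a b)"
proof (cases "b = 0")
  case True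
  then show ?thesis by (simp add: qd_hessian_def[abs_def])
next
  case False
  with assms have "z \<notin> N" by blast
  then show ?thesis
    unfolding qd_hessian_def[abs_def] by (intro continuous_intros) auto
qed

lemma C2_quadratic_distance:
  fixes z :: "real^'n::finite"
  assumes "y \<noteq> z \<or> b = 0"
  shows "C2_near (quadratic_distance z a b c) y"
    and "grad (quadratic_distance z a b c) y = qd_grad z a b y"
    and "hessian (quadratic_distance z a b c) y = qd_hessian z a b y"
proof -
  \<comment> \<open>\<open>C2_near\<close> asks for a whole neighborhood; the center must be removed
    exactly when the linear term is present.\<close>
  define N where "N = (if b = 0 then UNIV else - {z})"
  have N: "open N" "y \<in> N" "\<And>y. y \<in> N \<Longrightarrow> y \<noteq> z \<or> b = 0" "b \<noteq> 0 \<Longrightarrow> z \<notin> N"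
    using assms by (auto simp: N_def split: if_splits)
  note C2 = C2_onI[OF N(1) quadratic_distance_has_derivative[OF N(3)]
      qd_grad_has_derivative[OF N(3)] continuous_on_qd_hessian[OF N(4)]]
  show "C2_near (quadratic_distance z a b c) y"
    unfolding C2_near_def using C2(1) N by blast
  show "grad (quadratic_distance z a b c) y = qd_grad z a b y"
    "hessian (quadratic_distance z a b c) y = qd_hessian z a b y"
    using C2(2,3) N(2) by auto
qed

text \<open>The infinity Laplacian is the second derivative in the gradient direction. This
  direction is radial, and the second derivative of \<open>quadratic a b c\<close> is
  \<open>2 * a\<close>. The second assumption says that the radial derivative, hence the gradient,
  does not vanish.\<close>

lemma quadratic_distance_test_function:
  fixes z :: "real^'n::finite"
  assumes "y \<noteq> z" "2 * a * dist y z + b \<noteq> 0"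
  shows "quadratic_distance z a b c \<in> test_functions y"
    and "inf_laplacian (quadratic_distance z a b c) y = 2 * a"
proof -
  let ?f = "quadratic_distance z a b c" and ?r = "dist y z" and ?q = "2 * a + b / dist y z"
  have r: "?r > 0" using assms by simp
  have q: "?q \<noteq> 0" using assms by (auto simp: field_simps)
  have C2: "C2_near ?f y" "grad ?f y = ?q *\<^sub>R (y - z)" "hessian ?f y = qd_hessian z a b y"
    using C2_quadratic_distance[of y z b] assms(1) by (auto simp: qd_grad_def)
  have nz: "grad ?f y \<noteq> 0" using q assms(1) C2 by simp
  then show "?f \<in> test_functions y" using C2 by (simp add: test_functions_def)
  have n: "(norm (grad ?f y))\<^sup>2 = ?q\<^sup>2 * ?r\<^sup>2"
    by (simp add: C2 dist_norm power_mult_distrib)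
  have d: "(y - z) \<bullet> grad ?f y = ?q * ?r\<^sup>2"
    by (simp add: C2(2) dist_norm power2_norm_eq_inner)
  have "grad ?f y \<bullet> (hessian ?f y *v grad ?f y)
      = ?q * (?q\<^sup>2 * ?r\<^sup>2) - b / ?r ^ 3 * (?q * ?r\<^sup>2)\<^sup>2"
    unfolding C2(3) inner_qd_hessian n d ..
  also have "\<dots> = (?q\<^sup>2 * ?r\<^sup>2) * (?q - b / ?r)"
    using r by (simp add: power_mult_distrib power2_eq_square power3_eq_cube algebra_simps)
  finally show "inf_laplacian ?f y = 2 * a"
    using q r by (simp add: inf_laplacian_hessian[OF nz] n)
qed

text \<open>The gradient vanishes at the center, so the limit definition applies; the quotient is
  constantly \<open>2 * a\<close> away from \<open>z\<close>.\<close>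

lemma quadratic_distance_test_function_center:
  fixes z :: "real^'n::finite"
  shows "quadratic_distance z a 0 c \<in> test_functions z"
    and "inf_laplacian (quadratic_distance z a 0 c) z = 2 * a"
proof -
  let ?f = "quadratic_distance z a 0 c"
  have grad: "grad ?f z = 0" "C2_near ?f z"
    using C2_quadratic_distance[of z z 0] by (auto simp: qd_grad_def)
  have "\<forall>\<^sub>F x in at z. second_order_quotient ?f z x = 2 * a"
    by (auto simp: second_order_quotient_def quadratic_distance_def quadratic_def dist_norm
        eventually_at intro!: exI[of _ 1])
  then have lim: "(second_order_quotient ?f z \<longlongrightarrow> 2 * a) (at z)"
    by (rule tendsto_eventually)
  then show "?f \<in> test_functions z" using grad by (auto simp: test_functions_def)
  show "inf_laplacian ?f z = 2 * a"
    using grad lim by (simp add: inf_laplacian_def tendsto_Lim)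
qed

section \<open>Duality under negation\<close>

text \<open>At a noncritical point the formula is cubic over quadratic in the derivatives of
  \<open>f\<close>, hence odd; at a critical point the second order quotient changes sign together
  with its limit.\<close>

lemma test_functions_uminus:
  fixes f :: "real^'n::finite \<Rightarrow> real"
  assumes "f \<in> test_functions x"
  shows "(\<lambda>y. - f y) \<in> test_functions x"
    and "inf_laplacian (\<lambda>y. - f y) x = - inf_laplacian f x"
proof -
  let ?f = "\<lambda>y. - f y"
  obtain N where N: "open N" "x \<in> N" "C2_on N f"
    using assms by (auto simp: test_functions_def C2_near_def)
  note D = C2_onD[OF N(3)]
  have 1: "(?f has_derivative (\<lambda>v. - grad f y \<bullet> v)) (at y)" if "y \<in> N" for y
    using has_derivative_minus[OF D(1)[OF that]] by simp
  have 2: "((\<lambda>y. - grad f y) has_derivative (\<lambda>v. - hessian f y *v v)) (at y)" if "y \<in> N" for y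
    using has_derivative_minus[OF D(2)[OF that]]
    by (simp add: matrix_vector_mult_diff_rdistrib[of 0, simplified])
  note I = C2_onI[OF N(1) 1 2 continuous_on_minus[OF D(3)]]
  have C2: "C2_near ?f x" "grad ?f x = - grad f x" "hessian ?f x = - hessian f x"
    using I N by (auto simp: C2_near_def)
  have soq: "second_order_quotient ?f x = (\<lambda>y. - second_order_quotient f x y)"
    by (simp add: second_order_quotient_def[abs_def] fun_eq_iff minus_divide_left del: minus_divide_left[symmetric])
  show "?f \<in> test_functions x"
    using assms C2 tendsto_minus[of "second_order_quotient f x"]
    by (auto simp: test_functions_def soq)
  show "inf_laplacian ?f x = - inf_laplacian f x"
  proof (cases "grad f x = 0")
    case True
    then obtain L where L: "(second_order_quotient f x \<longlongrightarrow> L) (at x)"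
      using assms by (auto simp: test_functions_def)
    with tendsto_Lim[OF _ L] tendsto_Lim[OF _ tendsto_minus[OF L]] True C2(2) show ?thesis
      by (simp add: inf_laplacian_def soq)
  next
    case False
    then show ?thesis using C2(2,3)
      by (simp add: inf_laplacian_hessian matrix_vector_mult_diff_rdistrib[of 0, simplified]
          matrix_vector_mult_diff_distrib[of _ 0, simplified])
  qed
qed

lemma le_inf_laplacian_upper_iff:
  "ereal k \<le> inf_laplacian_upper u x \<longleftrightarrow>
     (\<forall>f\<in>test_functions x. local_min_at (\<lambda>y. f y - u y) x \<longrightarrow> k \<le> inf_laplacian f x)"
  by (auto simp: inf_laplacian_upper_def le_INF_iff)

text \<open>Negation is an involution of the test functions at \<open>x\<close> that turns touching
  from below into touching from above.\<close>

lemma inf_laplacian_lower_le_iff: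
  "inf_laplacian_lower u x \<le> ereal k \<longleftrightarrow> ereal (- k) \<le> inf_laplacian_upper (\<lambda>y. - u y) x"
proof -
  have lower: "inf_laplacian_lower u x \<le> ereal k \<longleftrightarrow>
     (\<forall>f\<in>test_functions x. local_max_at (\<lambda>y. f y - u y) x \<longrightarrow> inf_laplacian f x \<le> k)"
    by (auto simp: inf_laplacian_lower_def SUP_le_iff)
  have max: "local_max_at (\<lambda>y. f y - u y) x \<longleftrightarrow> local_min_at (\<lambda>y. - f y - - u y) x" for f
    unfolding local_max_at_def local_min_at_def by (simp add: algebra_simps)
  show ?thesis
    unfolding lower le_inf_laplacian_upper_iff
  proof (intro iffI ballI impI)
    fix f
    assume all: "\<forall>f\<in>test_functions x. local_max_at (\<lambda>y. f y - u y) x \<longrightarrow> inf_laplacian f x \<le> k"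
      and f: "f \<in> test_functions x" "local_min_at (\<lambda>y. f y - - u y) x"
    have "local_max_at (\<lambda>y. - f y - u y) x"
      using f(2) by (simp add: max)
    with all test_functions_uminus[OF f(1)] show "- k \<le> inf_laplacian f x"
      by fastforce
  next
    fix f
    assume all: "\<forall>f\<in>test_functions x. local_min_at (\<lambda>y. f y - - u y) x \<longrightarrow> - k \<le> inf_laplacian f x"
      and f: "f \<in> test_functions x" "local_max_at (\<lambda>y. f y - u y) x"
    with test_functions_uminus[OF f(1)] show "inf_laplacian f x \<le> k"
      unfolding max by fastforce
  qed
qed

lemma quadratic_distance_uminus:
  "quadratic_distance z (- a) (- b) (- c) x = - quadratic_distance z a b c x"
  by (simp add: quadratic_distance_def quadratic_def)

text \<open>Negating the three coefficients exchanges star-decreasing with star-increasing and the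
  supremum bound with the infimum bound.\<close>

lemma quadratic_comparison_below_iff:
  "quadratic_comparison_below U g u \<longleftrightarrow> quadratic_comparison_above U (\<lambda>y. - g y) (\<lambda>y. - u y)"
proof -
  have inf: "ereal (- a) \<le> (INF y\<in>V. ereal (- g y / 2)) \<longleftrightarrow> (SUP y\<in>V. ereal (g y / 2)) \<le> ereal a" for a V
    by (auto simp: le_INF_iff SUP_le_iff)
  have "quadratic_comparison_above U (\<lambda>y. - g y) (\<lambda>y. - u y)" (is ?A)
    if B: "quadratic_comparison_below U g u"
    unfolding quadratic_comparison_above_def
  proof (intro allI impI)
    fix V z a b c
    assume "open V" "closure V \<subseteq> U" "star_increasing V z a b c"
      "ereal a \<le> (INF y\<in>V. ereal (- g y / 2))"
      "\<forall>x\<in>frontier V. - u x \<le> quadratic_distance z a b c x"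
    with B[unfolded quadratic_comparison_below_def, rule_format, of V z "- a" "- b" "- c"]
    show "\<forall>x\<in>V. - u x \<le> quadratic_distance z a b c x"
      using inf[of "- a" V] by (auto simp: star_decreasing_def quadratic_distance_uminus minus_le_iff)
  qed
  moreover have "quadratic_comparison_below U g u" if A: ?A
    unfolding quadratic_comparison_below_def
  proof (intro allI impI)
    fix V z a b c
    assume "open V" "closure V \<subseteq> U" "star_decreasing V z a b c"
      "(SUP y\<in>V. ereal (g y / 2)) \<le> ereal a"
      "\<forall>x\<in>frontier V. quadratic_distance z a b c x \<le> u x"
    with A[unfolded quadratic_comparison_above_def, rule_format, of V z "- a" "- b" "- c"]
    show "\<forall>x\<in>V. quadratic_distance z a b c x \<le> u x"
      using inf[of a V] by (auto simp: star_decreasing_def quadratic_distance_uminus)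
  qed
  ultimately show ?thesis by blast
qed

lemma deriv_quadratic: "deriv (quadratic a b c) r = 2 * a * r + b"
  unfolding quadratic_def[abs_def]
  by (rule DERIV_imp_deriv) (auto intro!: derivative_eq_intros)

lemma continuous_on_quadratic_distance: "continuous_on S (quadratic_distance z a b c)"
  unfolding quadratic_distance_def[abs_def] quadratic_def by (intro continuous_intros)

section \<open>Comparison from above and subsolutions\<close>

text \<open>With the center off \<open>V\<close>, add \<open>h * (2 * R * r - r\<^sup>2)\<close> with \<open>R\<close> bounding all radii \<open>r\<close>, so that \<open>Q'\<close> does not
  decrease; with the center in \<open>V\<close>, add \<open>h * (R\<^sup>2 - r\<^sup>2)\<close>, which keeps the linear term zero.\<close>

lemma star_increasing_strict_perturbation:
  fixes V :: "(real^'n::finite) set"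
  assumes inc: "star_increasing V z a b c"
    and V: "bounded V" and e: "e > 0"
  obtains a' b' c' where "a' < a"
    "\<And>y. y \<in> closure V \<Longrightarrow> quadratic_distance z a b c y \<le> quadratic_distance z a' b' c' y"
    "\<And>y. y \<in> closure V \<Longrightarrow> quadratic_distance z a' b' c' y < quadratic_distance z a b c y + e"
    "\<And>y. y \<in> V \<Longrightarrow> quadratic_distance z a' b' c' \<in> test_functions y"
    "\<And>y. y \<in> V \<Longrightarrow> inf_laplacian (quadratic_distance z a' b' c') y = 2 * a'"
proof -
  obtain R where R: "R > 0" "\<And>y. y \<in> closure V \<Longrightarrow> dist y z \<le> R"
  proof -
    obtain R where "\<forall>y\<in>closure V. dist z y \<le> R"
      using bounded_any_center[of "closure V" z] bounded_closure[OF V] by blast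
    then have "\<And>y. y \<in> closure V \<Longrightarrow> dist y z \<le> max R 1"
      by (force simp: dist_commute)
    then show ?thesis using that[of "max R 1"] by auto
  qed
  have RV: "dist y z \<le> R" if "y \<in> V" for y
    using R(2) closure_subset that by blast
  have sq: "(dist y z)\<^sup>2 \<le> R\<^sup>2" if "y \<in> closure V" for y
    using R that by (intro power_mono) auto
  have small: "h * R\<^sup>2 < e" if "0 < h" "h < e / R\<^sup>2" for h
    using that R(1) by (simp add: field_simps)
  show thesis
  proof (cases "z \<in> V")
    case False
    with inc have pos: "2 * a * dist y z + b > 0" if "y \<in> V" for y
      using that by (auto simp: star_increasing_def deriv_quadratic)
    define h where "h = e / R\<^sup>2 / 2"
    have h: "0 < h" "h < e / R\<^sup>2" using e R(1) by (auto simp: h_def divide_pos_pos intro!: divide_strict_left_mono)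
    have diff: "quadratic_distance z (a - h) (b + 2 * h * R) c y
        = quadratic_distance z a b c y + h * (R\<^sup>2 - (R - dist y z)\<^sup>2)" for y
      by (simp add: quadratic_distance_def quadratic_def power2_eq_square algebra_simps)
    have le: "(R - dist y z)\<^sup>2 \<le> R\<^sup>2" if "y \<in> closure V" for y
      using R that by (intro power_mono) auto
    have der: "y \<noteq> z" "2 * (a - h) * dist y z + (b + 2 * h * R) \<noteq> 0" if "y \<in> V" for y
    proof -
      show "y \<noteq> z" using that False by auto
      \<comment> \<open>The new radial derivative is the old one plus
        \<open>2 * h * (R - dist y z)\<close>, so it stays positive.\<close>
      have "h * dist y z \<le> h * R" using RV[OF that] h by simp
      then show "2 * (a - h) * dist y z + (b + 2 * h * R) \<noteq> 0"
        using pos[OF that] by (simp add: algebra_simps)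
    qed
    show thesis
    proof (rule that)
      fix y assume y: "y \<in> closure V"
      have "h * (R\<^sup>2 - (R - dist y z)\<^sup>2) \<le> h * R\<^sup>2"
        using h by (intro mult_left_mono) auto
      then show "quadratic_distance z (a - h) (b + 2 * h * R) c y < quadratic_distance z a b c y + e"
        unfolding diff using small[OF h] by linarith
      show "quadratic_distance z a b c y \<le> quadratic_distance z (a - h) (b + 2 * h * R) c y"
        unfolding diff using h le[OF y] by simp
    next
      fix y assume "y \<in> V"
      from quadratic_distance_test_function[OF der[OF this]]
      show "quadratic_distance z (a - h) (b + 2 * h * R) c \<in> test_functions y"
        "inf_laplacian (quadratic_distance z (a - h) (b + 2 * h * R) c) y = 2 * (a - h)"
        by blast+
    qed (use h in simp)
  next
    case True
    with inc have ab: "b = 0" "a > 0" by (auto simp: star_increasing_def)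
    \<comment> \<open>The bound by \<open>a\<close> keeps \<open>a - h\<close> positive, so the
      gradient still vanishes only at the center.\<close>
    define h where "h = min (e / R\<^sup>2) a / 2"
    have h: "0 < h" "h < e / R\<^sup>2" "h < a"
    proof -
      have "e / R\<^sup>2 > 0" using e R(1) by simp
      then show "0 < h" using ab(2) by (simp add: h_def)
      show "h < e / R\<^sup>2"
        using min.cobounded1[of "e / R\<^sup>2" a] \<open>0 < h\<close> unfolding h_def by linarith
      show "h < a"
        using min.cobounded2[of "e / R\<^sup>2" a] \<open>0 < h\<close> unfolding h_def by linarith
    qed
    have diff: "quadratic_distance z (a - h) 0 (c + h * R\<^sup>2) y
        = quadratic_distance z a b c y + h * (R\<^sup>2 - (dist y z)\<^sup>2)" for y
      using ab by (simp add: quadratic_distance_def quadratic_def algebra_simps)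
    show thesis
    proof (rule that)
      fix y assume y: "y \<in> closure V"
      have "h * (R\<^sup>2 - (dist y z)\<^sup>2) \<le> h * R\<^sup>2"
        using h by (intro mult_left_mono) auto
      then show "quadratic_distance z (a - h) 0 (c + h * R\<^sup>2) y < quadratic_distance z a b c y + e"
        unfolding diff using small[OF h(1,2)] by linarith
      show "quadratic_distance z a b c y \<le> quadratic_distance z (a - h) 0 (c + h * R\<^sup>2) y"
        unfolding diff using h sq[OF y] by simp
    next
      fix y assume "y \<in> V"
      have "y = z \<or> y \<noteq> z \<and> 2 * (a - h) * dist y z + 0 \<noteq> 0" using h by auto
      then show "quadratic_distance z (a - h) 0 (c + h * R\<^sup>2) \<in> test_functions y"
        "inf_laplacian (quadratic_distance z (a - h) 0 (c + h * R\<^sup>2)) y = 2 * (a - h)"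
        using quadratic_distance_test_function quadratic_distance_test_function_center by blast+
    qed (use h in auto)
  qed
qed

text \<open>A violation at \<open>x\<close> leaves room to lower the quadratic term while staying
  below \<open>u\<close> at \<open>x\<close> and above \<open>u\<close> on the frontier. The contact
  point \<open>w\<close> is then interior, and \<open>g w \<le> 2 * a' < 2 * a \<le> g w\<close> is
  absurd.\<close>

lemma quadratic_comparison_aboveI:
  fixes U :: "(real^'n::finite) set"
  assumes U: "bounded U" and u: "continuous_on U u"
    and visc: "\<And>x. x \<in> U \<Longrightarrow> ereal (g x) \<le> inf_laplacian_upper u x"
  shows "quadratic_comparison_above U g u"
  unfolding quadratic_comparison_above_def
proof (intro allI impI ballI, rule ccontr)
  fix V z a b c x
  assume V: "open V" "closure V \<subseteq> U" and inc: "star_increasing V z a b c"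
    and a: "ereal a \<le> (INF y\<in>V. ereal (g y / 2))"
    and bd: "\<forall>x\<in>frontier V. u x \<le> quadratic_distance z a b c x"
    and x: "x \<in> V" "\<not> u x \<le> quadratic_distance z a b c x"
  have VU: "V \<subseteq> U" "x \<in> closure V" using V(2) closure_subset x by blast+
  have bV: "bounded V" using U VU(1) bounded_subset by blast
  have e: "0 < u x - quadratic_distance z a b c x" using x(2) by simp
  obtain a' b' c' where
    a': "a' < a" and
    ge: "\<And>y. y \<in> closure V \<Longrightarrow> quadratic_distance z a b c y \<le> quadratic_distance z a' b' c' y" and
    lt: "\<And>y. y \<in> closure V \<Longrightarrow> quadratic_distance z a' b' c' y
      < quadratic_distance z a b c y + (u x - quadratic_distance z a b c x)" and
    test: "\<And>y. y \<in> V \<Longrightarrow> quadratic_distance z a' b' c' \<in> test_functions y"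
      "\<And>y. y \<in> V \<Longrightarrow> inf_laplacian (quadratic_distance z a' b' c') y = 2 * a'"
    by (rule star_increasing_strict_perturbation[OF inc bV e]) blast
  let ?f = "quadratic_distance z a' b' c'"
  have "\<exists>w\<in>closure V. \<forall>y\<in>closure V. ?f w - u w \<le> ?f y - u y"
    using bV VU(2) u V(2)
    by (intro continuous_attains_inf continuous_on_diff continuous_on_quadratic_distance)
      (auto simp: compact_closure elim: continuous_on_subset)
  then obtain w where w: "w \<in> closure V" "\<And>y. y \<in> closure V \<Longrightarrow> ?f w - u w \<le> ?f y - u y"
    by blast
  have "?f w < u w" using w(2)[OF VU(2)] lt[OF VU(2)] by linarith
  then have "w \<notin> frontier V" using bd ge[OF w(1)] by force
  then have wV: "w \<in> V" using w(1) V(1) by (simp add: frontier_def interior_open)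
  have "local_min_at (\<lambda>y. ?f y - u y) w"
    unfolding local_min_at_def eventually_nhds
    using V(1) wV w(2) closure_subset by blast
  then have "g w \<le> 2 * a'"
    using visc[of w] VU wV test unfolding le_inf_laplacian_upper_iff by fastforce
  moreover have "a \<le> g w / 2" using a wV by (auto simp: le_INF_iff)
  ultimately show False using a' by simp
qed

section \<open>From comparison to the viscosity inequality\<close>

text \<open>Lowering the function by the minimum of its difference with \<open>u\<close> over a
  small sphere keeps it above \<open>u\<close> on the sphere but puts it below \<open>u\<close> at
  \<open>x\<close>. The assumption \<open>inc\<close> makes it star-increasing on small balls around
  \<open>x\<close>.\<close>

lemma quadratic_comparison_above_no_strict_touching:
  fixes U :: "(real^'n::finite) set"
  assumes comp: "quadratic_comparison_above U g u"
    and U: "open U" "x \<in> U" and u: "continuous_on U u" and g: "continuous_on U g"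
    and a: "2 * a < g x"
    and inc: "z = x \<and> b = 0 \<and> a > 0 \<or> z \<noteq> x \<and> 2 * a * dist x z + b > 0"
  shows "\<not> (\<forall>\<^sub>F y in at x. quadratic_distance z a b c x - u x < quadratic_distance z a b c y - u y)"
proof
  let ?f = "quadratic_distance z a b c"
  assume "\<forall>\<^sub>F y in at x. ?f x - u x < ?f y - u y"
  moreover have "\<forall>\<^sub>F y in at x. y \<in> U"
    using U by (rule eventually_at_in_open')
  moreover have "\<forall>\<^sub>F y in at x. 2 * a < g y"
    using U g a by (intro order_tendstoD) (auto simp: continuous_on_eq_continuous_at isCont_def)
  moreover have "\<forall>\<^sub>F y in at x. z \<noteq> x \<longrightarrow> y \<noteq> z \<and> 2 * a * dist y z + b > 0"
  proof (cases "z = x")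
    case False
    then have "\<forall>\<^sub>F y in at x. 2 * a * dist y z + b > 0"
      using inc by (intro order_tendstoD(1)[of _ "2 * a * dist x z + b"] tendsto_intros) auto
    moreover have "\<forall>\<^sub>F y in at x. y \<noteq> z"
      using False by (simp add: eventually_neq_at_within)
    ultimately show ?thesis by eventually_elim auto
  qed simp
  ultimately have "\<forall>\<^sub>F y in at x. ?f x - u x < ?f y - u y \<and> y \<in> U \<and> 2 * a < g y \<and>
      (z \<noteq> x \<longrightarrow> y \<noteq> z \<and> 2 * a * dist y z + b > 0)"
    by eventually_elim auto
  \<comment> \<open>The closed inequality \<open>dist y x \<le> d\<close> brings the sphere itself
    into the good neighborhood.\<close>
  then obtain d where d: "d > 0" "\<And>y. y \<noteq> x \<Longrightarrow> dist y x \<le> d \<Longrightarrow> ?f x - u x < ?f y - u y \<and>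
      y \<in> U \<and> 2 * a < g y \<and> (z \<noteq> x \<longrightarrow> y \<noteq> z \<and> 2 * a * dist y z + b > 0)"
    by (auto simp: eventually_at_le)
  have near: "y \<in> U" "2 * a < g y" "z \<noteq> x \<Longrightarrow> y \<noteq> z \<and> 2 * a * dist y z + b > 0"
    if "dist y x \<le> d" for y
    using d(2)[OF _ that] U(2) a inc by (cases "y = x"; auto)+
  have sub: "cball x d \<subseteq> U" using near by (auto simp: dist_commute)
  have "\<exists>w\<in>sphere x d. \<forall>y\<in>sphere x d. ?f w - u w \<le> ?f y - u y"
    using u sub d(1)
    by (intro continuous_attains_inf continuous_on_diff continuous_on_quadratic_distance)
      (auto elim!: continuous_on_subset)
  then obtain w where w: "dist w x = d" "\<And>y. dist y x = d \<Longrightarrow> ?f w - u w \<le> ?f y - u y"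
    by (force simp: dist_commute)
  let ?m = "?f w - u w"
  have shift: "quadratic_distance z a b (c - ?m) y = ?f y - ?m" for y
    by (simp add: quadratic_distance_def quadratic_def)
  have inc': "star_increasing (ball x d) z a b (c - ?m)"
  proof (cases "z = x")
    case True
    then show ?thesis using inc d(1) by (auto simp: star_increasing_def)
  next
    case False
    then have "y \<noteq> z \<and> 2 * a * dist y z + b > 0" if "y \<in> ball x d" for y
      using near(3)[of y] that by (simp add: dist_commute)
    then show ?thesis
      unfolding star_increasing_def deriv_quadratic by blast
  qed
  have "u x \<le> quadratic_distance z a b (c - ?m) x"
  proof (rule comp[unfolded quadratic_comparison_above_def, rule_format, OF _ _ inc'])
    show "closure (ball x d) \<subseteq> U" using sub d(1) by simp
    show "ereal a \<le> (INF y\<in>ball x d. ereal (g y / 2))"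
    proof (intro INF_greatest)
      fix y assume "y \<in> ball x d"
      then show "ereal a \<le> ereal (g y / 2)" using near(2)[of y] by (simp add: dist_commute)
    qed
    show "u y \<le> quadratic_distance z a b (c - ?m) y" if "y \<in> frontier (ball x d)" for y
      using that d(1) w(2)[of y] unfolding shift by (auto simp: dist_commute)
  qed (use d(1) in simp_all)
  then have "u x \<le> ?f x - ?m" unfolding shift .
  moreover have "?f x - u x < ?m" using d(2)[of w] w(1) d(1) by auto
  ultimately show False by linarith
qed

text \<open>With \<open>s = dist y z - R\<close>, the comparison function is \<open>u x - \<epsilon> + a' s\<^sup>2 + q s\<close>. Since \<open>a' < 0\<close> and the
  center lies outside \<open>V\<close>, it is star-increasing only where \<open>2 a' s + q > 0\<close>; but it lies above
  the given parabola wherever \<open>s \<ge> \<epsilon> / q\<close>.\<close>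

lemma quadratic_comparison_above_no_concave_touching:
  fixes U :: "(real^'n::finite) set"
  assumes comp: "quadratic_comparison_above U g u"
    and U: "open U" "x \<in> U" and u: "continuous_on U u" and g: "continuous_on U g"
    and a: "2 * a < g x" and neg: "g x \<le> 0"
  shows "\<not> (\<forall>\<^sub>F y in at x. u y \<le> u x + a * (dist y x)\<^sup>2)"
proof
  assume "\<forall>\<^sub>F y in at x. u y \<le> u x + a * (dist y x)\<^sup>2"
  moreover have "\<forall>\<^sub>F y in at x. y \<in> U"
    using U by (rule eventually_at_in_open')
  \<comment> \<open>The midpoint of \<open>a\<close> and \<open>g x / 2\<close>: negative, still
    admissible near \<open>x\<close>, and above \<open>a\<close> by a margin
    \<open>k\<close>.\<close>
  moreover define a' where "a' = (a + g x / 2) / 2"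
  have a': "a < a'" "2 * a' < g x" "a' < 0" using a neg by (auto simp: a'_def field_simps)
  have "\<forall>\<^sub>F y in at x. 2 * a' < g y"
    using U g a' by (intro order_tendstoD) (auto simp: continuous_on_eq_continuous_at isCont_def)
  ultimately have "\<forall>\<^sub>F y in at x. u y \<le> u x + a * (dist y x)\<^sup>2 \<and> y \<in> U \<and> 2 * a' < g y"
    by eventually_elim auto
  then obtain d where d: "d > 0" "\<And>y. y \<noteq> x \<Longrightarrow> dist y x \<le> d \<Longrightarrow>
      u y \<le> u x + a * (dist y x)\<^sup>2 \<and> y \<in> U \<and> 2 * a' < g y"
    by (auto simp: eventually_at_le)
  have near: "y \<in> U" "2 * a' < g y" "u y \<le> u x + a * (dist y x)\<^sup>2" if "dist y x \<le> d" for y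
    using d(2)[OF _ that] U(2) a' by (cases "y = x"; auto)+
  define k where "k = a' - a"
  \<comment> \<open>At distance \<open>d\<close> from \<open>x\<close> the linear term and the shift
    \<open>e\<close> cost at most \<open>q * d + e \<le> k * d\<^sup>2\<close>, the gap between the
    two parabolas. The second bound on \<open>e\<close> serves monotonicity, and
    \<open>R > d\<close> puts the center outside the ball.\<close>
  define q where "q = k * d / 2"
  define e where "e = min (k * d\<^sup>2 / 2) (q\<^sup>2 / (- 4 * a'))"
  define R where "R = d + 1"
  have k: "k > 0" using a' by (simp add: k_def)
  have q: "q > 0" using k d(1) by (simp add: q_def)
  have e: "e > 0" "e \<le> k * d\<^sup>2 / 2" "e \<le> q\<^sup>2 / (- 4 * a')"
    using k q d(1) a' by (auto simp: e_def divide_pos_neg zero_less_divide_iff)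
  obtain z where z: "dist x z = R"
    using vector_choose_dist[of R x] d(1) by (auto simp: R_def)
  let ?s = "\<lambda>y. dist y z - R"
  define b c where "b = q - 2 * a' * R" and "c = u x - e + a' * R\<^sup>2 - q * R"
  let ?f = "quadratic_distance z a' b c"
  have f: "?f y = u x - e + a' * (?s y)\<^sup>2 + q * ?s y" for y
    by (simp add: quadratic_distance_def quadratic_def b_def c_def power2_eq_square algebra_simps)
  have s: "\<bar>?s y\<bar> \<le> dist y x" for y
    using abs_dist_diff_le[of y z x] z by (simp add: dist_commute)
  have s2: "a' * (dist y x)\<^sup>2 \<le> a' * (?s y)\<^sup>2" for y
    using power_mono[OF s, of y 2] a'(3) by simp
  \<comment> \<open>A frontier point lies either on the sphere or inside the ball with
    \<open>?f \<ge> u\<close>.\<close>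
  define V where "V = {y \<in> ball x d. ?f y - u y < 0}"
  have sub: "cball x d \<subseteq> U" using near by (auto simp: dist_commute)
  have V: "open V"
  proof -
    have "continuous_on (ball x d) (\<lambda>y. ?f y - u y)"
      using sub u ball_subset_cball by (intro continuous_on_diff continuous_on_quadratic_distance)
        (blast intro: continuous_on_subset)
    then have "open ((\<lambda>y. ?f y - u y) -` {..<0} \<inter> ball x d)"
      using continuous_on_open_vimage[OF open_ball] open_lessThan by (metis (lifting))
    moreover have "(\<lambda>y. ?f y - u y) -` {..<0} \<inter> ball x d = V" by (auto simp: V_def)
    ultimately show ?thesis by simp
  qed
  have clV: "closure V \<subseteq> cball x d"
    by (rule closure_minimal) (auto simp: V_def)
  have V_near: "dist y x < d" "?f y < u y" if "y \<in> V" for y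
    using that by (auto simp: V_def dist_commute)
  have inc: "star_increasing V z a' b c"
    unfolding star_increasing_def deriv_quadratic
  proof (intro disjI1 conjI ballI)
    show "z \<notin> V" using z V_near(1)[of z] by (auto simp: R_def dist_commute)
    fix y assume y: "y \<in> V"
    \<comment> \<open>With \<open>e \<le> q\<^sup>2 / (- 4 * a')\<close> this yields
      \<open>2 * a' * ?s y > - q / 2\<close>, so the radial derivative exceeds
      \<open>q / 2\<close>.\<close>
    have "q * ?s y < e"
    proof -
      have "u x - e + a' * (?s y)\<^sup>2 + q * ?s y < u x + a * (dist y x)\<^sup>2"
        using V_near[OF y] near(3)[of y] f[of y] by linarith
      moreover have "a * (dist y x)\<^sup>2 \<le> a' * (dist y x)\<^sup>2"
        using a'(1) by (intro mult_right_mono) auto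
      ultimately show ?thesis using s2[of y] by linarith
    qed
    also note e(3)
    finally have "q * ?s y * (- 4 * a') < q * q"
      using a'(3) by (simp add: field_simps power2_eq_square)
    then have "q * (?s y * (- 4 * a')) < q * q" by (simp add: mult.assoc)
    then have "?s y * (- 4 * a') < q" using q by (simp only: mult_less_cancel_left_pos)
    then show "0 < 2 * a' * dist y z + b"
      using q unfolding b_def by (simp add: algebra_simps)
  qed
  have fx: "?f x = u x - e" by (simp add: f z)
  then have "x \<in> V" using e(1) d(1) by (simp add: V_def)
  have "u x \<le> ?f x"
  proof (rule comp[unfolded quadratic_comparison_above_def, rule_format, OF V _ inc])
    show "closure V \<subseteq> U" using clV sub by blast
    show "ereal a' \<le> (INF y\<in>V. ereal (g y / 2))"
    proof (intro INF_greatest)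
      fix y assume "y \<in> V"
      then show "ereal a' \<le> ereal (g y / 2)" using near(2)[of y] V_near(1)[of y] by simp
    qed
    fix y assume y: "y \<in> frontier V"
    then have yc: "dist y x \<le> d" and yV: "y \<notin> V"
      using clV V by (auto simp: frontier_def interior_open dist_commute)
    show "u y \<le> ?f y"
    proof (cases "dist y x = d")
      case True
      have "q * - d \<le> q * ?s y" using s[of y] q True by (intro mult_left_mono) auto
      moreover have "q * d + e \<le> k * d\<^sup>2"
        using e(2) by (simp add: q_def power2_eq_square)
      moreover have "u y \<le> u x + a * d\<^sup>2" using near(3)[OF yc] True by simp
      ultimately show ?thesis
        using s2[of y] True unfolding f k_def by (simp add: algebra_simps)
    next
      case False
      with yc yV show ?thesis by (auto simp: V_def dist_commute)
    qed
  qed (rule \<open>x \<in> V\<close>)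
  then show False using fx e(1) by simp
qed

text \<open>Write \<open>grad f x = P e\<close> with \<open>|e| = 1\<close>. A quadratic distance function centered at \<open>x - (P / M) e\<close>
  with slope \<open>P\<close> at \<open>x\<close> has the same gradient as \<open>f\<close> there, and its Hessian is
  \<open>2 a e e\<^sup>T + M (I - e e\<^sup>T)\<close>, which dominates that of \<open>f\<close> for large \<open>M\<close>.\<close>

lemma quadratic_comparison_above_no_noncritical_touching:
  fixes U :: "(real^'n::finite) set"
  assumes comp: "quadratic_comparison_above U g u"
    and U: "open U" "x \<in> U" and u: "continuous_on U u" and g: "continuous_on U g"
    and N: "open N" "x \<in> N" "C2_on N f"
    and grad: "grad f x \<noteq> 0" and lap: "inf_laplacian f x < g x"
  shows "\<not> local_min_at (\<lambda>y. f y - u y) x"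
proof
  assume min: "local_min_at (\<lambda>y. f y - u y) x"
  define p where "p = grad f x"
  define P where "P = norm p"
  define e where "e = p /\<^sub>R P"
  define A where "A = hessian f x"
  have P: "P > 0" using grad by (simp add: P_def p_def)
  have e: "e \<bullet> e = 1" "p = P *\<^sub>R e"
    using P by (simp_all add: e_def P_def dot_square_norm power2_eq_square)
  have L: "e \<bullet> (A *v e) < g x"
    using lap P inf_laplacian_hessian[OF grad]
    by (simp add: p_def[symmetric] P_def[symmetric] A_def[symmetric] e(2) matrix_vector_mult_scaleR
        power2_eq_square norm_eq_1[THEN iffD2, OF e(1)])
  obtain a where a: "e \<bullet> (A *v e) < 2 * a" "2 * a < g x"
    using L that[of "(e \<bullet> (A *v e) + g x) / 4"] by simp
  define k where "k = 2 * a - e \<bullet> (A *v e)"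
  have k: "k > 0" using a by (simp add: k_def)
  obtain C where C: "C > 0" "\<And>v. norm (A *v v) \<le> norm v * C"
    using bounded_linear.pos_bounded[OF matrix_vector_mul_bounded_linear[of A]] by blast
  \<comment> \<open>Chosen so that \<open>(M - C) * k > C\<^sup>2\<close>, which makes the form in
    \<open>s\<close> and \<open>norm w\<close> below positive definite.\<close>
  define M where "M = C + C\<^sup>2 / k + 1"
  have M: "M > 0" "(M - C) * k > C\<^sup>2" 
  proof -
    have "C\<^sup>2 / k > 0" using C(1) k by simp
    then show "M > 0" using C(1) by (simp add: M_def)
    have "(M - C) * k = C\<^sup>2 + k" using k by (simp add: M_def field_simps)
    then show "(M - C) * k > C\<^sup>2" using k by simp
  qed
  have form: "v \<bullet> (A *v v) < M * (norm v)\<^sup>2 - (M - 2 * a) * (e \<bullet> v)\<^sup>2" if v: "v \<noteq> 0" for v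
  proof -
    \<comment> \<open>Split \<open>v\<close> into its component along \<open>e\<close> and an
      orthogonal rest \<open>w\<close>; the bound on \<open>A\<close> controls the mixed
      terms.\<close>
    define s where "s = e \<bullet> v"
    define w where "w = v - s *\<^sub>R e"
    have vw: "v = s *\<^sub>R e + w" by (simp add: w_def)
    have we: "w \<bullet> e = 0" "e \<bullet> w = 0" using e by (simp_all add: w_def s_def inner_diff_right inner_diff_left inner_commute)
    have nv: "(norm v)\<^sup>2 = s\<^sup>2 + (norm w)\<^sup>2"
      unfolding power2_norm_eq_inner
      by (simp add: vw inner_add_left inner_add_right we e power2_eq_square)
    have bil: "\<bar>y \<bullet> (A *v y')\<bar> \<le> C * (norm y * norm y')" for y y'
    proof -
      have "\<bar>y \<bullet> (A *v y')\<bar> \<le> norm y * norm (A *v y')" by (rule Cauchy_Schwarz_ineq2)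
      also have "\<dots> \<le> norm y * (norm y' * C)" using C by (intro mult_left_mono) auto
      finally show ?thesis by (simp add: mult_ac)
    qed
    have ne: "norm e = 1" using e by (simp add: norm_eq_1)
    have "v \<bullet> (A *v v) = s\<^sup>2 * (e \<bullet> (A *v e)) + s * (e \<bullet> (A *v w)) + s * (w \<bullet> (A *v e)) + w \<bullet> (A *v w)"
      by (simp add: vw matrix_vector_right_distrib matrix_vector_mult_scaleR inner_add_left
          inner_add_right power2_eq_square algebra_simps)
    also have "s * (e \<bullet> (A *v w)) \<le> \<bar>s\<bar> * (C * norm w)"
      using mult_mono[OF order_refl bil[of e w], of "\<bar>s\<bar>"] ne abs_le_D1[OF order_refl, of "s * (e \<bullet> (A *v w))"]
      by (simp add: abs_mult)
    also have "s * (w \<bullet> (A *v e)) \<le> \<bar>s\<bar> * (C * norm w)"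
      using mult_mono[OF order_refl bil[of w e], of "\<bar>s\<bar>"] ne abs_le_D1[OF order_refl, of "s * (w \<bullet> (A *v e))"]
      by (simp add: abs_mult)
    also have "w \<bullet> (A *v w) \<le> C * (norm w)\<^sup>2"
      using bil[of w w] by (simp add: power2_eq_square)
    finally have up: "v \<bullet> (A *v v) \<le> s\<^sup>2 * (2 * a - k) + 2 * (\<bar>s\<bar> * C * norm w) + C * (norm w)\<^sup>2"
      by (simp add: k_def mult_ac)
    have pos: "0 < k * s\<^sup>2 - 2 * (\<bar>s\<bar> * C * norm w) + (M - C) * (norm w)\<^sup>2"
    proof (cases "w = 0")
      case True
      then have "s \<noteq> 0" using v vw by auto
      then show ?thesis using k True by simp
    next
      case False
      \<comment> \<open>Completing the square after multiplication by \<open>k\<close>.\<close>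
      have "0 < (k * \<bar>s\<bar> - C * norm w)\<^sup>2 + ((M - C) * k - C\<^sup>2) * (norm w)\<^sup>2"
        using M(2) False by (intro add_nonneg_pos mult_pos_pos) auto
      also have "\<dots> = k * (k * s\<^sup>2 - 2 * (\<bar>s\<bar> * C * norm w) + (M - C) * (norm w)\<^sup>2)"
      proof -
        have "s\<^sup>2 = \<bar>s\<bar> * \<bar>s\<bar>" by (simp add: power2_eq_square)
        then show ?thesis by (simp add: power2_eq_square algebra_simps)
      qed
      finally show ?thesis using k by (simp add: zero_less_mult_iff)
    qed
    have "M * (norm v)\<^sup>2 - (M - 2 * a) * s\<^sup>2 = 2 * a * s\<^sup>2 + M * (norm w)\<^sup>2"
      unfolding nv by (simp add: algebra_simps)
    with up pos show ?thesis
      unfolding s_def[symmetric] by (simp add: algebra_simps)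
  qed
  define r where "r = P / M"
  have r: "r > 0" using P M by (simp add: r_def)
  define z where "z = x - r *\<^sub>R e"
  define b where "b = P - 2 * a * r"
  have xz: "x - z = r *\<^sub>R e" "dist x z = r"
    using e r by (simp_all add: z_def dist_norm norm_eq_1)
  have zx: "z \<noteq> x" using xz r by auto
  \<comment> \<open>The tangential eigenvalue of the quadratic's Hessian at \<open>x\<close> is
    \<open>M\<close>; along \<open>e\<close> it drops by \<open>M - 2 * a\<close> to
    \<open>2 * a\<close>.\<close>
  have coef: "2 * a + b / r = M" "b / r ^ 3 * r\<^sup>2 = M - 2 * a"
    using r M P by (simp_all add: b_def r_def field_simps power2_eq_square power3_eq_cube)
  let ?q = "quadratic_distance z a b 0"
  define N' where "N' = N - {z}"
  have N': "open N'" "x \<in> N'" "N' \<subseteq> N" "z \<notin> N'" using N zx by (auto simp: N'_def)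
  have "\<forall>\<^sub>F y in at x. ?q x - f x < ?q y - f y"
  proof (rule strict_local_min_second_derivative[OF N'(1,2),
        where G = "\<lambda>y. qd_grad z a b y - grad f y" and H = "\<lambda>y. qd_hessian z a b y - hessian f y"])
    fix y assume "y \<in> N'"
    with N' have y: "y \<in> N" "y \<noteq> z" by auto
    show "((\<lambda>y. ?q y - f y) has_derivative (\<lambda>v. (qd_grad z a b y - grad f y) \<bullet> v)) (at y)"
      using has_derivative_diff[OF quadratic_distance_has_derivative C2_onD(1)[OF N(3)]] y
      by (simp add: inner_diff_left)
    show "((\<lambda>y. qd_grad z a b y - grad f y) has_derivative
        (\<lambda>v. (qd_hessian z a b y - hessian f y) *v v)) (at y)"
      using has_derivative_diff[OF qd_grad_has_derivative C2_onD(2)[OF N(3)]] y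
      by (simp add: matrix_vector_mult_diff_rdistrib)
  next
    show "continuous_on N' (\<lambda>y. qd_hessian z a b y - hessian f y)"
      using N' C2_onD(3)[OF N(3)]
      by (intro continuous_on_diff continuous_on_qd_hessian) (auto elim: continuous_on_subset)
    have "M * r = P" using M by (simp add: r_def)
    then show "qd_grad z a b x - grad f x = 0"
      unfolding qd_grad_def xz coef using e(2) by (simp add: p_def)
  next
    fix v :: "real^'n" assume v: "v \<noteq> 0"
    have "v \<bullet> (qd_hessian z a b x *v v) = M * (norm v)\<^sup>2 - b / r ^ 3 * r\<^sup>2 * (e \<bullet> v)\<^sup>2"
      unfolding inner_qd_hessian xz coef(1) by (simp add: power_mult_distrib)
    then show "0 < v \<bullet> ((qd_hessian z a b x - hessian f x) *v v)"
      using form[OF v] unfolding coef(2) A_def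
      by (simp add: matrix_vector_mult_diff_rdistrib inner_diff_right)
  qed
  moreover have "\<forall>\<^sub>F y in at x. f x - u x \<le> f y - u y"
    using min unfolding local_min_at_def eventually_at_filter by eventually_elim auto
  ultimately have "\<forall>\<^sub>F y in at x. ?q x - u x < ?q y - u y"
    by eventually_elim linarith
  moreover have "2 * a * dist x z + b > 0" using P by (simp add: xz b_def)
  ultimately show False
    using quadratic_comparison_above_no_strict_touching[OF comp U u g a(2), of z b 0] zx by blast
qed

text \<open>A test function with too small a value is noncritical, which is already excluded, or
  critical; then its limit \<open>L < g x\<close> bounds \<open>u\<close> near \<open>x\<close> by a
  parabola with \<open>2 * a < g x\<close>, and the sign of \<open>g x\<close> decides which
  touching lemma applies.\<close>

lemma quadratic_comparison_above_imp_upper: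
  fixes U :: "(real^'n::finite) set"
  assumes comp: "quadratic_comparison_above U g u"
    and U: "open U" "x \<in> U" and u: "continuous_on U u" and g: "continuous_on U g"
  shows "ereal (g x) \<le> inf_laplacian_upper u x"
  unfolding le_inf_laplacian_upper_iff
proof (intro ballI impI, rule ccontr)
  fix f assume f: "f \<in> test_functions x" and min: "local_min_at (\<lambda>y. f y - u y) x"
    and "\<not> g x \<le> inf_laplacian f x"
  then have lap: "inf_laplacian f x < g x" by simp
  obtain N where N: "open N" "x \<in> N" "C2_on N f"
    using f by (auto simp: test_functions_def C2_near_def)
  have "grad f x = 0"
    using quadratic_comparison_above_no_noncritical_touching[OF comp U u g N _ lap] min by blast
  with f lap obtain L where L: "(second_order_quotient f x \<longlongrightarrow> L) (at x)" "L < g x"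
    by (auto simp: test_functions_def inf_laplacian_def tendsto_Lim)
  \<comment> \<open>Raising \<open>L\<close> to at least \<open>0\<close> when
    \<open>g x > 0\<close> makes \<open>a\<close> positive, as a paraboloid centered at
    \<open>x\<close> requires; \<open>2 * a\<close> is the midpoint of \<open>m\<close> and
    \<open>g x\<close>.\<close>
  define m where "m = (if g x > 0 then max L 0 else L)"
  have m: "L \<le> m" "m < g x" "g x > 0 \<Longrightarrow> m \<ge> 0" using L by (auto simp: m_def)
  define a where "a = (m + g x) / 4"
  have a: "L < 2 * a" "2 * a < g x" "g x > 0 \<Longrightarrow> a > 0" using m by (auto simp: a_def)
  have "\<forall>\<^sub>F y in at x. second_order_quotient f x y < 2 * a"
    using L(1) a(1) by (rule order_tendstoD)
  moreover have "\<forall>\<^sub>F y in at x. f x - u x \<le> f y - u y"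
    using min unfolding local_min_at_def eventually_at_filter by eventually_elim auto
  moreover have "\<forall>\<^sub>F y in at x. y \<noteq> x" by (simp add: eventually_neq_at_within)
  ultimately have touch: "\<forall>\<^sub>F y in at x. u y < u x + a * (dist y x)\<^sup>2"
  proof eventually_elim
    case (elim y)
    then have "f y - f x < a * (dist y x)\<^sup>2"
      by (simp add: second_order_quotient_def dist_norm field_simps)
    with elim show ?case by linarith
  qed
  show False
  proof (cases "g x > 0")
    case True
    have "\<forall>\<^sub>F y in at x. quadratic_distance x a 0 0 x - u x < quadratic_distance x a 0 0 y - u y"
      using touch by eventually_elim (simp add: quadratic_distance_def quadratic_def)
    then show False
      using quadratic_comparison_above_no_strict_touching[OF comp U u g a(2), of x 0 0] a(3) True
      by blast
  next
    case False
    moreover have "\<forall>\<^sub>F y in at x. u y \<le> u x + a * (dist y x)\<^sup>2"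
      using touch by eventually_elim simp
    ultimately show False
      using quadratic_comparison_above_no_concave_touching[OF comp U u g a(2)] by simp
  qed
qed

section \<open>Equivalence of the two notions\<close>

lemma quadratic_comparison_above_iff:
  fixes U :: "(real^'n::finite) set"
  assumes "open U" "bounded U" "continuous_on U u" "continuous_on U g"
  shows "quadratic_comparison_above U g u \<longleftrightarrow> (\<forall>x\<in>U. ereal (g x) \<le> inf_laplacian_upper u x)"
  using quadratic_comparison_aboveI[OF assms(2,3), of g]
    quadratic_comparison_above_imp_upper[OF _ assms(1) _ assms(3,4)] by blast

theorem theorem1p7:
  fixes U :: "(real ^ 'n::finite) set" and u g :: "real ^ 'n \<Rightarrow> real"
  assumes "open U" and "connected U" and "U \<noteq> {}" and "bounded U"
    and "continuous_on U u" and "continuous_on U g"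
  shows "quadratic_comparison U g u \<longleftrightarrow> viscosity_solution U g u"
proof -
  have "quadratic_comparison_below U g u \<longleftrightarrow> (\<forall>x\<in>U. inf_laplacian_lower u x \<le> ereal (g x))"
    unfolding quadratic_comparison_below_iff inf_laplacian_lower_le_iff
    using assms by (intro quadratic_comparison_above_iff continuous_on_minus)
  moreover have "quadratic_comparison_above U g u \<longleftrightarrow> (\<forall>x\<in>U. ereal (g x) \<le> inf_laplacian_upper u x)"
    using assms by (intro quadratic_comparison_above_iff)
  ultimately show ?thesis
    by (auto simp: quadratic_comparison_def viscosity_solution_def assms(5))
qed

end
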